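(* Let $\gamma\in(0,1]$, $\lambda>0$, $\kappa\in[0,1)$. The distribution $\mathrm{PDS}(\gamma,\lambda,\kappa)$ belongs to the domain of normal attraction of the $\alpha$-stable distribution with $\alpha=\gamma$ and characteristic function $$g(t)=\exp\left\{-\frac{\lambda}{(1-\kappa)^{\gamma}}\cos\left(\frac{\pi\gamma}{2}\right)|t|^{\gamma}\left(1-\mathrm{i}\,\mathrm{sign}(t)\tan\left(\frac{\pi\gamma}{2}\right)\right)\right\}.$$
   Context: For $\gamma\in(0,1]$, $\lambda>0$, $\kappa\in[0,1)$, $\mathrm{PDS}(\gamma,\lambda,\kappa)$ denotes the distribution on $\mathbb{N}_0$ with probability generating function $\mathrm{E}z^X=\exp\left\{-\lambda\left(\frac{1-z}{1-\kappa z}\right)^{\gamma}\right\}$. Belonging to the domain of normal attraction of the law with characteristic function $g$ (index $\alpha$) means here: if $X_1,X_2,\dots$ are i.i.d. with the given distribution, then $n^{-1/\alpha}(X_1+\dots+X_n)$ converges in distribution, as $n\to\infty$, to the law with characteristic function $g$. The product $\cos(\pi\gamma/2)\left(1-\mathrm{i}\,\mathrm{sign}(t)\tan(\pi\gamma/2)\right)$ is read as $\cos(\pi\gamma/2)-\mathrm{i}\,\mathrm{sign}(t)\sin(\pi\gamma/2)$, which also covers $\gamma=1$ (where the limit law is degenerate). *)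

theory Defs
  imports
    "HOL-Probability.Probability"
    "HOL-Complex_Analysis.Complex_Analysis"
    "HOL-Real_Asymp.Real_Asymp"
begin

section \<open>The distribution PDS\<close>

text \<open>
  The law with the prescribed probability generating function is introduced by a definite
  description. Its existence and uniqueness are established below, in \<open>PDS_pgf\<close> and
  \<open>PDS_eqI\<close>. At \<open>z = 1\<close> the convention \<open>0 powr \<gamma> = 0\<close> is the correct value
  because \<open>\<gamma> > 0\<close>.
\<close>
definition PDS :: "real \<Rightarrow> real \<Rightarrow> real \<Rightarrow> nat pmf" where
  "PDS \<gamma> lam \<kappa> = (THE p. \<forall>z\<in>{0..1::real}.
     measure_pmf.expectation p (\<lambda>n. z ^ n) = exp (- lam * ((1 - z) / (1 - \<kappa> * z)) powr \<gamma>))"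

subsection \<open>Existence and uniqueness\<close>

lemma nn_pgf_sums:
  fixes z v :: real
  assumes "0 \<le> z" "(\<lambda>n. pmf p n * z ^ n) sums v"
  shows "(\<integral>\<^sup>+n. ennreal (z ^ n) \<partial>measure_pmf p) = ennreal v"
proof -
  have "(\<integral>\<^sup>+n. ennreal (z ^ n) \<partial>measure_pmf p) = (\<Sum>n. ennreal (pmf p n * z ^ n))"
    by (simp add: nn_integral_measure_pmf nn_integral_count_space_nat ennreal_mult' pmf_nonneg)
  also have "\<dots> = ennreal v"
    using assms by (subst suminf_ennreal2) (auto simp: sums_iff)
  finally show ?thesis .
qed

lemma pgf_sums:
  fixes z :: real
  assumes "\<bar>z\<bar> \<le> 1"
  shows "(\<lambda>n. pmf p n * z ^ n) sums measure_pmf.expectation p (\<lambda>n. z ^ n)"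
proof -
  have 1: "integrable (measure_pmf p) (\<lambda>n. z ^ n)"
    using assms
    by (intro measure_pmf.integrable_const_bound[where B = 1]) (auto simp: power_abs power_le_one)
  have "integrable (count_space UNIV) (\<lambda>n. pmf p n * z ^ n)"
    using 1 unfolding measure_pmf_eq_density by (subst (asm) integrable_density) auto
  then have "(\<lambda>n. pmf p n * z ^ n) sums (\<integral>n. pmf p n * z ^ n \<partial>count_space UNIV)"
    by (rule sums_integral_count_space_nat)
  also have "(\<integral>n. pmf p n * z ^ n \<partial>count_space UNIV) = measure_pmf.expectation p (\<lambda>n. z ^ n)"
    unfolding measure_pmf_eq_density by (subst integral_density) auto
  finally show ?thesis .
qed

lemma expectation_pgf_eqI:
  fixes z v :: real
  assumes "0 \<le> z" "0 \<le> v" "(\<integral>\<^sup>+n. ennreal (z ^ n) \<partial>measure_pmf p) = ennreal v"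
  shows "measure_pmf.expectation p (\<lambda>n. z ^ n) = v"
  using assms by (subst integral_eq_nn_integral) auto

lemma pmf_eqI_pgf:
  fixes p q :: "nat pmf"
  assumes eq: "\<And>z::real. z \<in> {0..1} \<Longrightarrow>
    measure_pmf.expectation p (\<lambda>n. z ^ n) = measure_pmf.expectation q (\<lambda>n. z ^ n)"
  shows "p = q"
proof -
  define a where "a = (\<lambda>n. pmf p n - pmf q n)"
  define f where "f = (\<lambda>z::real. measure_pmf.expectation p (\<lambda>n. z ^ n) - measure_pmf.expectation q (\<lambda>n. z ^ n))"
  have sums: "(\<lambda>n. a n * z ^ n) sums f z" if "\<bar>z\<bar> \<le> 1" for z
    unfolding a_def f_def left_diff_distrib by (intro sums_diff pgf_sums that)
  have f0: "f z = 0" if "z \<in> {0..1}" for z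
    using eq[OF that] by (simp add: f_def)
  have a0: "a 0 = 0"
    using sums[of 0] f0[of 0] powser_sums_zero_iff[of a "f 0"] by auto
  have "a m = 0" for m
  proof (rule ccontr)
    assume m: "a m \<noteq> 0"
    obtain s where s: "0 < s" "\<And>z. z \<in> cball 0 s - {0} \<Longrightarrow> f z \<noteq> 0"
      by (rule powser_0_nonzero[of 1 0 a f m]) (use m a0 sums f0 in \<open>auto intro!: gr0I\<close>)
    show False
    proof (cases "s \<le> 1")
      case True
      then show ?thesis using s(1) s(2)[of s] f0[of s] by auto
    next
      case False
      then show ?thesis using s(2)[of 1] f0[of 1] by auto
    qed
  qed
  then show ?thesis
    by (intro pmf_eqI) (simp add: a_def)
qed

primrec nfold_sum_pmf :: "nat \<Rightarrow> nat pmf \<Rightarrow> nat pmf" where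
  "nfold_sum_pmf 0 p = return_pmf 0"
| "nfold_sum_pmf (Suc n) p = p \<bind> (\<lambda>k. map_pmf ((+) k) (nfold_sum_pmf n p))"

lemma nn_pgf_nfold_sum:
  fixes z :: real
  assumes "0 \<le> z"
  shows "(\<integral>\<^sup>+k. ennreal (z ^ k) \<partial>measure_pmf (nfold_sum_pmf n p)) =
         (\<integral>\<^sup>+k. ennreal (z ^ k) \<partial>measure_pmf p) ^ n"
  using assms
  by (induction n) (simp_all add: power_add ennreal_mult nn_integral_cmult nn_integral_multc mult.commute)

lemma nn_pgf_compound:
  fixes z r :: real
  assumes "0 \<le> z" "0 \<le> r" "(\<integral>\<^sup>+k. ennreal (z ^ k) \<partial>measure_pmf p) = ennreal r"
  shows "(\<integral>\<^sup>+k. ennreal (z ^ k) \<partial>measure_pmf (N \<bind> (\<lambda>n. nfold_sum_pmf n p))) =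
         (\<integral>\<^sup>+n. ennreal (r ^ n) \<partial>measure_pmf N)"
  using assms by (simp add: nn_pgf_nfold_sum ennreal_power)

lemma nn_pgf_geometric:
  fixes \<kappa> z :: real
  assumes "0 \<le> \<kappa>" "\<kappa> < 1" "z \<in> {0..1}"
  shows "(\<integral>\<^sup>+k. ennreal (z ^ k) \<partial>measure_pmf (map_pmf Suc (geometric_pmf (1 - \<kappa>)))) =
         ennreal ((1 - \<kappa>) * z / (1 - \<kappa> * z))"
proof -
  have kz: "\<kappa> * z < 1" "0 \<le> \<kappa> * z"
    using assms mult_left_le[of z \<kappa>] by auto
  have "(\<lambda>n. (\<kappa> * z) ^ n) sums (1 / (1 - \<kappa> * z))"
    using kz by (intro geometric_sums) auto
  then have "(\<lambda>n. (1 - \<kappa>) * (\<kappa> * z) ^ n) sums ((1 - \<kappa>) * (1 / (1 - \<kappa> * z)))"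
    by (rule sums_mult)
  then have "(\<lambda>n. pmf (geometric_pmf (1 - \<kappa>)) n * z ^ n) sums ((1 - \<kappa>) / (1 - \<kappa> * z))"
    using assms by (simp add: power_mult_distrib mult_ac)
  then have "(\<integral>\<^sup>+n. ennreal (z ^ n) \<partial>measure_pmf (geometric_pmf (1 - \<kappa>))) = ennreal ((1 - \<kappa>) / (1 - \<kappa> * z))"
    using assms by (intro nn_pgf_sums) auto
  then show ?thesis
  proof -
    have "(\<integral>\<^sup>+k. ennreal (z ^ k) \<partial>measure_pmf (map_pmf Suc (geometric_pmf (1 - \<kappa>)))) =
          (\<integral>\<^sup>+k. ennreal z * ennreal (z ^ k) \<partial>measure_pmf (geometric_pmf (1 - \<kappa>)))"
      using assms by (simp add: ennreal_mult)
    also have "\<dots> = ennreal z * ennreal ((1 - \<kappa>) / (1 - \<kappa> * z))"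
      using \<open>_ = ennreal ((1 - \<kappa>) / (1 - \<kappa> * z))\<close> by (subst nn_integral_cmult) auto
    also have "\<dots> = ennreal ((1 - \<kappa>) * z / (1 - \<kappa> * z))"
      using assms kz by (subst ennreal_mult[symmetric]) (auto simp: mult_ac)
    finally show ?thesis .
  qed
qed

lemma nn_pgf_poisson:
  fixes lam z :: real
  assumes "0 < lam" "0 \<le> z"
  shows "(\<integral>\<^sup>+k. ennreal (z ^ k) \<partial>measure_pmf (poisson_pmf lam)) = ennreal (exp (lam * (z - 1)))"
proof -
  have "(\<lambda>n. (lam * z) ^ n /\<^sub>R fact n * exp (- lam)) sums (exp (lam * z) * exp (- lam))"
    by (intro sums_mult2 exp_converges)
  then have "(\<lambda>n. pmf (poisson_pmf lam) n * z ^ n) sums exp (lam * (z - 1))"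
    using assms by (simp add: power_mult_distrib field_simps exp_diff exp_minus)
  then show ?thesis
    using assms by (intro nn_pgf_sums) auto
qed

lemma sibuya_exists:
  fixes \<gamma> :: real
  assumes "0 < \<gamma>" "\<gamma> \<le> 1"
  shows "\<exists>p :: nat pmf. \<forall>w\<in>{0..1}. (\<integral>\<^sup>+k. ennreal (w ^ k) \<partial>measure_pmf p) = ennreal (1 - (1 - w) powr \<gamma>)"
proof -
  define f where "f = (\<lambda>n. if n = 0 then 0 else - ((- 1) ^ n * (\<gamma> gchoose n)))"
  have nonneg: "0 \<le> f n" for n
  proof (cases n)
    case (Suc k)
    have "f n = \<gamma> / real (Suc k) * ((- 1) ^ k * (\<gamma> - 1 gchoose k))"
      using gbinomial_rec[of "\<gamma> - 1" k] by (simp add: f_def Suc)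
    also have "(- 1) ^ k * (\<gamma> - 1 gchoose k) = pochhammer (1 - \<gamma>) k / fact k"
      by (simp add: gbinomial_pochhammer flip: power_mult_distrib mult.assoc)
    finally show ?thesis
      using assms by (simp add: pochhammer_nonneg pochhammer_prod prod_nonneg)
  qed (simp add: f_def)
  have lim: "(\<lambda>n. (- 1) ^ n * (\<gamma> - 1 gchoose n)) \<longlonglongrightarrow> 0"
  proof -
    have "(\<lambda>n. exp (- (\<gamma> * ln (real n)))) \<longlonglongrightarrow> 0"
      using assms by real_asymp
    then have "(\<lambda>n. (\<gamma> - 1 gchoose n) / ((- 1) ^ n / exp (\<gamma> * ln (real n))) * exp (- (\<gamma> * ln (real n)))) \<longlonglongrightarrow>
        inverse (Gamma (- (\<gamma> - 1))) * 0"
      using gbinomial_asymptotic[of "\<gamma> - 1"] by (intro tendsto_mult) auto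
    also have "(\<lambda>n. (\<gamma> - 1 gchoose n) / ((- 1) ^ n / exp (\<gamma> * ln (real n))) * exp (- (\<gamma> * ln (real n)))) =
        (\<lambda>n. (- 1) ^ n * (\<gamma> - 1 gchoose n))"
      by (auto simp: fun_eq_iff exp_minus field_simps simp flip: power_mult_distrib)
    finally show ?thesis by simp
  qed
  have part: "(\<Sum>n\<le>m. f n) = 1 - (- 1) ^ m * (\<gamma> - 1 gchoose m)" for m
    unfolding gbinomial_sum_lower_neg[symmetric] by (induction m) (simp_all add: f_def)
  have sum1: "f sums 1"
    unfolding sums_def_le part using tendsto_diff[OF tendsto_const lim, of 1] by simp
  have "(\<integral>\<^sup>+n. ennreal (f n) \<partial>count_space UNIV) = 1"
    using sum1 nonneg by (simp add: nn_integral_count_space_nat suminf_ennreal2 sums_iff)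
  then have pmf: "pmf (embed_pmf f) n = f n" for n
    using nonneg by (simp add: pmf_embed_pmf)
  show ?thesis
  proof (intro exI ballI)
    fix w :: real assume w: "w \<in> {0..1}"
    have "(\<lambda>n. f n * w ^ n) sums (1 - (1 - w) powr \<gamma>)"
    proof (cases "w = 1")
      case True
      then show ?thesis using sum1 assms by simp
    next
      case False
      have "(\<lambda>n. (\<gamma> gchoose n) * (- w) ^ n) sums (1 - w) powr \<gamma>"
        using gen_binomial_real[of "-w" \<gamma>] False w by simp
      then have "(\<lambda>n. (if n = 0 then 1 else 0) - (\<gamma> gchoose n) * (- w) ^ n) sums (1 - (1 - w) powr \<gamma>)"
        using sums_single[of 0 "\<lambda>_. 1::real"] by (intro sums_diff) auto
      also have "(\<lambda>n. (if n = 0 then 1 else 0) - (\<gamma> gchoose n) * (- w) ^ n) = (\<lambda>n. f n * w ^ n)"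
        by (auto simp: f_def fun_eq_iff power_minus[of w])
      finally show ?thesis .
    qed
    then show "(\<integral>\<^sup>+k. ennreal (w ^ k) \<partial>measure_pmf (embed_pmf f)) = ennreal (1 - (1 - w) powr \<gamma>)"
      using w by (intro nn_pgf_sums) (auto simp: pmf)
  qed
qed

text \<open>
  Existence: with \<open>w = (1 - \<kappa>) z / (1 - \<kappa> z)\<close> the generating function equals
  \<open>exp (lam ((1 - (1 - w) powr \<gamma>) - 1))\<close>, a Poisson-stopped sum of Sibuya-stopped sums of
  shifted geometric variables.
\<close>
lemma PDS_pgf:
  assumes "0 < \<gamma>" "\<gamma> \<le> 1" "0 < lam" "0 \<le> \<kappa>" "\<kappa> < 1" "z \<in> {0..1}"
  shows "measure_pmf.expectation (PDS \<gamma> lam \<kappa>) (\<lambda>n. z ^ n) =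
         exp (- lam * ((1 - z) / (1 - \<kappa> * z)) powr \<gamma>)"
proof -
  let ?P = "\<lambda>p. \<forall>z\<in>{0..1::real}.
     measure_pmf.expectation p (\<lambda>n. z ^ n) = exp (- lam * ((1 - z) / (1 - \<kappa> * z)) powr \<gamma>)"
  obtain s :: "nat pmf" where s: "\<And>w. w \<in> {0..1} \<Longrightarrow>
      (\<integral>\<^sup>+k. ennreal (w ^ k) \<partial>measure_pmf s) = ennreal (1 - (1 - w) powr \<gamma>)"
    using sibuya_exists[OF assms(1,2)] by blast
  define J where "J = s \<bind> (\<lambda>n. nfold_sum_pmf n (map_pmf Suc (geometric_pmf (1 - \<kappa>))))"
  define p where "p = poisson_pmf lam \<bind> (\<lambda>n. nfold_sum_pmf n J)"
  have "?P p"
  proof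
    fix z :: real assume z: "z \<in> {0..1}"
    have kz: "\<kappa> * z < 1"
      using assms z mult_left_le[of z \<kappa>] by auto
    let ?w = "(1 - \<kappa>) * z / (1 - \<kappa> * z)"
    have w: "?w \<in> {0..1}" "1 - ?w = (1 - z) / (1 - \<kappa> * z)"
      using assms z kz mult_right_mono[of \<kappa> 1 z] by (auto simp: field_simps)
    have r: "(1 - ?w) powr \<gamma> \<le> 1"
      using w(1) assms by (intro powr_le1) auto
    have "(\<integral>\<^sup>+k. ennreal (z ^ k) \<partial>measure_pmf J) = ennreal (1 - (1 - ?w) powr \<gamma>)"
      unfolding J_def using assms z w(1) by (subst nn_pgf_compound[OF _ _ nn_pgf_geometric]) (auto simp: s)
    then have "(\<integral>\<^sup>+k. ennreal (z ^ k) \<partial>measure_pmf p) = ennreal (exp (lam * ((1 - (1 - ?w) powr \<gamma>) - 1)))"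
      unfolding p_def using assms z r by (subst nn_pgf_compound) (auto simp: nn_pgf_poisson)
    then show "measure_pmf.expectation p (\<lambda>n. z ^ n) = exp (- lam * ((1 - z) / (1 - \<kappa> * z)) powr \<gamma>)"
      using z w(2) by (intro expectation_pgf_eqI) auto
  qed
  moreover have "q = p" if "?P q" for q
    using that \<open>?P p\<close> by (intro pmf_eqI_pgf) auto
  ultimately have "?P (PDS \<gamma> lam \<kappa>)"
    unfolding PDS_def by (rule theI)
  then show ?thesis
    using assms by blast
qed

lemma PDS_eqI:
  assumes "0 < \<gamma>" "\<gamma> \<le> 1" "0 < lam" "0 \<le> \<kappa>" "\<kappa> < 1"
    and "\<And>z::real. z \<in> {0..1} \<Longrightarrow>
      measure_pmf.expectation p (\<lambda>n. z ^ n) = exp (- lam * ((1 - z) / (1 - \<kappa> * z)) powr \<gamma>)"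
  shows "p = PDS \<gamma> lam \<kappa>"
  using assms by (intro pmf_eqI_pgf) (auto simp: PDS_pgf)


section \<open>Stable laws and domains of normal attraction\<close>

text \<open>
  Stability in the wide sense: for every \<open>n \<ge> 1\<close> the sum of \<open>n\<close> independent copies of a
  variable with law \<open>L\<close> is distributed as \<open>n powr (1/\<alpha>) X + d\<close> for a single such
  variable and some constant \<open>d\<close>. Point masses are not excluded.
\<close>

definition stable_law :: "real \<Rightarrow> real measure \<Rightarrow> bool" where
  "stable_law \<alpha> L \<longleftrightarrow> 0 < \<alpha> \<and> \<alpha> \<le> 2 \<and> real_distribution L \<and>
     (\<forall>n\<ge>1. \<exists>d. distr (\<Pi>\<^sub>M i\<in>{..<n}. L) borel (\<lambda>x. \<Sum>i<n. x i) =
                  distr L borel (\<lambda>x. real n powr (1 / \<alpha>) * x + d))"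

text \<open>
  The type argument only names the type of the sample spaces quantified over; no centring is
  allowed.
\<close>

definition in_domain_of_normal_attraction ::
  "'a itself \<Rightarrow> real measure \<Rightarrow> real \<Rightarrow> real measure \<Rightarrow> bool" where
  "in_domain_of_normal_attraction (_ :: 'a itself) D \<alpha> L \<longleftrightarrow>
     (\<forall>(M :: 'a measure) (X :: nat \<Rightarrow> 'a \<Rightarrow> real).
        prob_space M \<and> prob_space.indep_vars M (\<lambda>_. borel) X UNIV \<and> (\<forall>i. distr M borel (X i) = D) \<longrightarrow>
        weak_conv_m (\<lambda>n. distr M borel (\<lambda>\<omega>. real n powr (- 1 / \<alpha>) * (\<Sum>i<n. X i \<omega>))) L)"

end

theory Submission
  imports Defs
begin

text \<open>
  The generating function of PDS extends to the closed unit disc with the same formula, so the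
  characteristic function is available in closed form. Write
  \<open>w(z) = (1 - z) / (1 - \<kappa> z)\<close>. This map sends the closed disc without \<open>1\<close> into the
  right half-plane (\<open>Re_moebius_pos\<close>), where the principal power is holomorphic, so the
  identity theorem carries the formula from \<open>(0, 1)\<close> to the open disc and continuity carries it
  to the circle (\<open>complex_pgf_eqI_cball\<close>).

  The \<open>n\<close>-th power of \<open>exp (- lam w(exp (i s)) powr \<gamma>)\<close> replaces \<open>lam\<close> by
  \<open>n lam\<close>. With \<open>s = n powr (- 1 / \<gamma>) t\<close> the factor \<open>n\<close> can be moved under the power as
  \<open>n powr (1 / \<gamma>) = t / s\<close>, and \<open>w(exp (i s)) / s\<close> tends to \<open>- i / (1 - \<kappa>)\<close>
  as \<open>s\<close> tends to 0. Hence the characteristic functions of the normalised sums converge to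
  \<open>exp (- lam (- i t / (1 - \<kappa>)) powr \<gamma>)\<close> (\<open>moebius_scaled_limit\<close>), which in polar
  form is the function in question (\<open>imaginary_powr\<close>).

  That this limit is a characteristic function at all is a matter of tightness. The normalised
  sums are nonnegative, and the inequality \<open>1 - exp (- s) \<le> s\<close> bounds their Laplace
  transforms from below, uniformly in \<open>n\<close>, by a function that tends to 1 at the origin
  (\<open>PDS_Laplace_bound\<close>, \<open>tight_if_Laplace_bound\<close>). A weak subsequential limit is then the
  required law \<open>L\<close> (\<open>stable_limit_exists\<close>). Convergence of the full sequence is Levy's
  continuity theorem, and stability of \<open>L\<close> follows from Levy's uniqueness theorem, because
  the exponent \<open>(- i t) powr \<gamma>\<close> is homogeneous of degree \<open>\<gamma>\<close> under positive scaling.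
\<close>

section \<open>Generating functions on the closed unit disc\<close>

lemma complex_pgf_sums:
  fixes z :: complex
  assumes "cmod z \<le> 1"
  shows "(\<lambda>n. of_real (pmf p n) * z ^ n) sums measure_pmf.expectation p (\<lambda>n. z ^ n)"
proof -
  have 1: "integrable (measure_pmf p) (\<lambda>n. z ^ n)"
    using assms
    by (intro measure_pmf.integrable_const_bound[where B = 1]) (auto simp: norm_power power_le_one)
  have "integrable (count_space UNIV) (\<lambda>n. pmf p n *\<^sub>R z ^ n)"
    using 1 unfolding measure_pmf_eq_density by (subst (asm) integrable_density) auto
  then have "(\<lambda>n. pmf p n *\<^sub>R z ^ n) sums (\<integral>n. pmf p n *\<^sub>R z ^ n \<partial>count_space UNIV)"
    by (rule sums_integral_count_space_nat)
  also have "(\<integral>n. pmf p n *\<^sub>R z ^ n \<partial>count_space UNIV) = measure_pmf.expectation p (\<lambda>n. z ^ n)"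
    unfolding measure_pmf_eq_density by (subst integral_density) auto
  finally show ?thesis
    by (simp add: scaleR_conv_of_real)
qed

lemma complex_pgf_of_real:
  "measure_pmf.expectation p (\<lambda>n. complex_of_real x ^ n) =
   of_real (measure_pmf.expectation p (\<lambda>n. x ^ n))"
  by (simp flip: of_real_power)

lemma continuous_on_complex_pgf:
  "continuous_on (cball 0 1) (\<lambda>z::complex. measure_pmf.expectation p (\<lambda>n. z ^ n))"
  unfolding continuous_on_sequentially comp_def
proof (intro allI ballI impI, elim conjE)
  fix u :: "nat \<Rightarrow> complex" and a
  assume u: "\<forall>n. u n \<in> cball 0 1" "u \<longlonglongrightarrow> a"
  show "(\<lambda>k. measure_pmf.expectation p (\<lambda>n. u k ^ n)) \<longlonglongrightarrow> measure_pmf.expectation p (\<lambda>n. a ^ n)"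
    by (rule integral_dominated_convergence[where w = "\<lambda>_. 1"])
       (use u in \<open>auto intro!: tendsto_intros simp: norm_power power_le_one\<close>)
qed

text \<open>
  A generating function is holomorphic inside the disc and the segment \<open>(0, 1)\<close> accumulates at
  the interior point 0, so the identity theorem applies.
\<close>
lemma complex_pgf_eqI_ball:
  assumes h: "h holomorphic_on ball 0 1"
    and eq: "\<And>x. 0 < x \<Longrightarrow> x < 1 \<Longrightarrow> h (complex_of_real x) = of_real (measure_pmf.expectation p (\<lambda>n. x ^ n))"
    and z: "z \<in> ball 0 1"
  shows "measure_pmf.expectation p (\<lambda>n. z ^ n) = h z"
proof -
  let ?f = "\<lambda>z::complex. measure_pmf.expectation p (\<lambda>n. z ^ n)"
  have f: "?f holomorphic_on ball 0 1"
    by (rule power_series_holomorphic[of _ _ "\<lambda>n. of_real (pmf p n)"])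
       (use complex_pgf_sums[of _ p] in auto)
  have "?f z - h z = 0"
  proof (rule analytic_continuation[of "\<lambda>z. ?f z - h z" "ball 0 1" "of_real ` {0<..<1}" 0])
    show "(\<lambda>z. ?f z - h z) holomorphic_on ball 0 1"
      by (intro holomorphic_intros f h)
    show "(0::complex) islimpt of_real ` {0<..<1}"
    proof -
      have "(\<lambda>n. 1 / real (n + 2)) \<longlonglongrightarrow> 0"
        by real_asymp
      from tendsto_of_real[OF this, where 'a = complex]
      show ?thesis
        unfolding islimpt_sequential
        by (intro exI[of _ "\<lambda>n. of_real (1 / real (n + 2))"]) (auto simp del: of_real_divide)
    qed
    show "?f w - h w = 0" if "w \<in> of_real ` {0<..<1}" for w
      using that eq by (auto simp: complex_pgf_of_real)
  qed (use z in auto)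
  then show ?thesis by simp
qed

text \<open>
  Abel's device: the formula passes from the open disc to a boundary point along the radius, since
  a generating function is continuous on the whole closed disc. Continuity of \<open>h\<close> at the
  single point \<open>z\<close> is asked for, so that \<open>h\<close> may have a branch point elsewhere on the
  circle.
\<close>
lemma complex_pgf_eqI_cball:
  assumes h: "h holomorphic_on ball 0 1"
    and eq: "\<And>x. 0 < x \<Longrightarrow> x < 1 \<Longrightarrow> h (complex_of_real x) = of_real (measure_pmf.expectation p (\<lambda>n. x ^ n))"
    and z: "cmod z \<le> 1" and cont: "isCont h z"
  shows "measure_pmf.expectation p (\<lambda>n. z ^ n) = h z"
proof -
  let ?f = "\<lambda>z::complex. measure_pmf.expectation p (\<lambda>n. z ^ n)"
  define u where "u = (\<lambda>k. of_real (1 - 1 / real (k + 2)) * z)"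
  have u_norm: "cmod (u k) < 1" for k
  proof -
    have "cmod (u k) \<le> 1 - 1 / real (k + 2)"
      using z by (simp add: u_def norm_mult mult_left_le del: of_real_diff of_nat_add)
    also have "\<dots> < 1" by simp
    finally show ?thesis .
  qed
  have "(\<lambda>k. 1 - 1 / real (k + 2)) \<longlonglongrightarrow> 1"
    by real_asymp
  from tendsto_mult[OF tendsto_of_real[OF this] tendsto_const[of z]] have u: "u \<longlonglongrightarrow> z"
    unfolding u_def by simp
  have "(\<lambda>k. ?f (u k)) \<longlonglongrightarrow> ?f z"
    using continuous_on_complex_pgf[of p] u u_norm z
    unfolding continuous_on_sequentially comp_def by (auto simp: less_imp_le)
  moreover have "(\<lambda>k. ?f (u k)) = (\<lambda>k. h (u k))"
    using complex_pgf_eqI_ball[OF h eq] u_norm by (auto simp: fun_eq_iff)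
  moreover have "(\<lambda>k. h (u k)) \<longlonglongrightarrow> h z"
    by (rule isCont_tendsto_compose[OF cont u])
  ultimately show ?thesis
    using LIMSEQ_unique by metis
qed

section \<open>The characteristic function of PDS\<close>

text \<open>
  Multiplying numerator and denominator by the conjugate of the denominator leaves the real part
  \<open>(1 - x) (1 - \<kappa> x) + \<kappa> y\<^sup>2\<close> at \<open>z = x + i y\<close>, and \<open>x < 1\<close> for every
  \<open>z\<close> of the closed disc except \<open>1\<close>.
\<close>
lemma Re_moebius_pos:
  fixes z :: complex
  assumes "cmod z \<le> 1" "z \<noteq> 1" "0 \<le> \<kappa>" "\<kappa> < 1"
  shows "0 < Re ((1 - z) / (1 - of_real \<kappa> * z))" "1 - of_real \<kappa> * z \<noteq> 0"
proof -
  have x: "Re z < 1"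
  proof (rule ccontr)
    assume "\<not> Re z < 1"
    with complex_Re_le_cmod[of z] assms have "Re z = 1" "cmod z = 1" by linarith+
    then have "Im z = 0" using cmod_power2[of z] by simp
    with \<open>Re z = 1\<close> assms show False by (simp add: complex_eq_iff)
  qed
  have kx: "\<kappa> * Re z < 1"
  proof (cases "Re z \<ge> 0")
    case True then show ?thesis using x assms mult_left_le[of "Re z" \<kappa>] by linarith
  next
    case False then show ?thesis using assms mult_nonneg_nonpos[of \<kappa> "Re z"] by linarith
  qed
  then show nz: "1 - of_real \<kappa> * z \<noteq> 0" by (auto simp: complex_eq_iff)
  have "0 < (1 - Re z) * (1 - \<kappa> * Re z) + \<kappa> * (Im z)\<^sup>2"
    using x kx assms by (intro add_pos_nonneg mult_pos_pos) auto
  moreover have "0 < (cmod (1 - of_real \<kappa> * z))\<^sup>2" using nz by simp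
  ultimately show "0 < Re ((1 - z) / (1 - of_real \<kappa> * z))"
    unfolding Re_divide cmod_power2 by (intro divide_pos_pos) (auto simp: power2_eq_square algebra_simps)
qed

text \<open>
  At the branch point \<open>z = 1\<close> the formula is the normalisation of the distribution and is
  checked separately; everywhere else the power is taken in the right half-plane.
\<close>
lemma PDS_complex_pgf:
  fixes z :: complex
  assumes "0 < \<gamma>" "\<gamma> \<le> 1" "0 < lam" "0 \<le> \<kappa>" "\<kappa> < 1" "cmod z \<le> 1"
  shows "measure_pmf.expectation (PDS \<gamma> lam \<kappa>) (\<lambda>n. z ^ n) =
         exp (- of_real lam * ((1 - z) / (1 - of_real \<kappa> * z)) powr of_real \<gamma>)"
proof (cases "z = 1")
  case True
  then show ?thesis using assms by simp
next
  case False
  let ?w = "\<lambda>z::complex. (1 - z) / (1 - of_real \<kappa> * z)"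
  have w: "?w z \<notin> \<real>\<^sub>\<le>\<^sub>0" "1 - of_real \<kappa> * z \<noteq> 0" if "cmod z \<le> 1" "z \<noteq> 1" for z
    using Re_moebius_pos[OF that assms(4,5)] by (auto simp: complex_nonpos_Reals_iff)
  show ?thesis
  proof (rule complex_pgf_eqI_cball)
    show "(\<lambda>z. exp (- of_real lam * ?w z powr of_real \<gamma>)) holomorphic_on ball 0 1"
    proof (intro holomorphic_intros)
      fix z :: complex assume "z \<in> ball 0 1"
      then have "cmod z \<le> 1" "z \<noteq> 1" by auto
      then show "?w z \<notin> \<real>\<^sub>\<le>\<^sub>0" "1 - of_real \<kappa> * z \<noteq> 0"
        by (fact w)+
    qed
    show "isCont (\<lambda>z. exp (- of_real lam * ?w z powr of_real \<gamma>)) z"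
      using w[OF assms(6) False] by (intro continuous_intros) auto
    fix x :: real assume x: "0 < x" "x < 1"
    then have "\<kappa> * x < 1" using assms mult_left_le[of x \<kappa>] by linarith
    then have "?w (of_real x) powr of_real \<gamma> = of_real (((1 - x) / (1 - \<kappa> * x)) powr \<gamma>)"
      using x powr_of_real[of "(1 - x) / (1 - \<kappa> * x)" \<gamma>] by simp
    then show "exp (- of_real lam * ?w (of_real x) powr of_real \<gamma>) =
        of_real (measure_pmf.expectation (PDS \<gamma> lam \<kappa>) (\<lambda>n. x ^ n))"
      using x assms by (simp add: PDS_pgf flip: exp_of_real)
  qed (use assms in auto)
qed

lemma char_PDS_scaled:
  assumes "0 < \<gamma>" "\<gamma> \<le> 1" "0 < lam" "0 \<le> \<kappa>" "\<kappa> < 1"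
  shows "char (distr (PDS \<gamma> lam \<kappa>) borel (\<lambda>k. c * real k)) t =
         exp (- of_real lam * ((1 - iexp (c * t)) / (1 - of_real \<kappa> * iexp (c * t))) powr of_real \<gamma>)"
proof -
  have "char (distr (PDS \<gamma> lam \<kappa>) borel (\<lambda>k. c * real k)) t =
        measure_pmf.expectation (PDS \<gamma> lam \<kappa>) (\<lambda>k. iexp (c * t) ^ k)"
  proof -
    have "iexp (t * (c * real k)) = iexp (c * t) ^ k" for k
      unfolding exp_of_nat_mult[symmetric] by (simp add: mult_ac)
    then show ?thesis
      unfolding char_def by (subst integral_distr) auto
  qed
  then show ?thesis
    using assms by (simp add: PDS_complex_pgf del: of_real_mult)
qed

section \<open>The limit of the characteristic functions\<close>

lemma powr_pos_real_mult:
  assumes "0 < r"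
  shows "(complex_of_real r * z) powr of_real a = of_real (r powr a) * z powr of_real a"
  using assms by (simp add: powr_times_real_left powr_of_real)

text \<open>
  Positive real factors may be moved in and out of a principal power, so \<open>n\<close> times the power is
  the power of \<open>n powr (1 / \<gamma>)\<close> times the quotient. The latter is a difference quotient of
  the exponential function divided by a factor that tends to \<open>1 - \<kappa>\<close>. For
  \<open>t \<noteq> 0\<close> its limit lies on the imaginary axis away from 0, hence off the branch cut, and
  the power is continuous there.
\<close>
lemma moebius_scaled_limit:
  fixes \<kappa> t \<gamma> :: real
  assumes "0 < \<gamma>" "0 \<le> \<kappa>" "\<kappa> < 1"
  shows "(\<lambda>n. of_nat n * ((1 - iexp (real n powr (- 1 / \<gamma>) * t)) /
            (1 - of_real \<kappa> * iexp (real n powr (- 1 / \<gamma>) * t))) powr of_real \<gamma>)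
         \<longlonglongrightarrow> of_real (1 / (1 - \<kappa>) powr \<gamma>) * (- \<i> * of_real t) powr of_real \<gamma>"
proof (cases "t = 0")
  case True
  then show ?thesis by simp
next
  case False
  define u where "u = (\<lambda>n. real n powr (- 1 / \<gamma>) * t)"
  have u0: "u \<longlonglongrightarrow> 0"
  proof -
    have "(\<lambda>n. real n powr (- 1 / \<gamma>)) \<longlonglongrightarrow> 0"
      using assms by real_asymp
    then show ?thesis unfolding u_def by (rule tendsto_mult_left_zero)
  qed
  have uc: "(\<lambda>n. complex_of_real (u n)) \<longlonglongrightarrow> 0"
    using tendsto_of_real[OF u0] by simp
  have u_nz: "\<forall>\<^sub>F n in sequentially. complex_of_real (u n) \<noteq> 0"
    using eventually_gt_at_top[of 0] by eventually_elim (use False in \<open>auto simp: u_def\<close>)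
  have "((\<lambda>z::complex. exp (\<i> * z)) has_field_derivative \<i>) (at 0)"
    by (auto intro!: derivative_eq_intros)
  then have "((\<lambda>z::complex. (exp (\<i> * z) - 1) / z) \<longlongrightarrow> \<i>) (at 0)"
    by (simp add: has_field_derivative_iff)
  then have quot: "(\<lambda>n. (iexp (u n) - 1) / of_real (u n)) \<longlonglongrightarrow> \<i>"
    by (rule filterlim_compose) (use uc u_nz in \<open>simp add: filterlim_at\<close>)
  have "(\<lambda>n. 1 - of_real \<kappa> * iexp (u n)) \<longlonglongrightarrow> 1 - of_real \<kappa> * exp (\<i> * 0)"
    by (intro tendsto_intros uc)
  then have den: "(\<lambda>n. 1 - of_real \<kappa> * iexp (u n)) \<longlonglongrightarrow> 1 - of_real \<kappa>"
    by simp
  \<comment> \<open>The sequence under the power once \<open>n powr (1 / \<gamma>) = t / u n\<close> has been absorbed.\<close>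
  let ?v = "\<lambda>n. - of_real t * ((iexp (u n) - 1) / of_real (u n)) / (1 - of_real \<kappa> * iexp (u n))"
  let ?l = "- of_real t * \<i> / (1 - of_real \<kappa>)"
  have "complex_of_real \<kappa> \<noteq> 1" using assms by simp
  then have v: "?v \<longlonglongrightarrow> ?l"
    by (intro tendsto_intros quot den) auto
  have "?l = of_real (1 / (1 - \<kappa>)) * (- \<i> * of_real t)" by simp
  also have "\<dots> powr of_real \<gamma> = of_real ((1 / (1 - \<kappa>)) powr \<gamma>) * (- \<i> * of_real t) powr of_real \<gamma>"
    using assms by (intro powr_pos_real_mult) auto
  finally have l_powr: "?l powr of_real \<gamma> = of_real (1 / (1 - \<kappa>) powr \<gamma>) * (- \<i> * of_real t) powr of_real \<gamma>"
    using assms by (simp add: powr_divide)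
  have "Im ?l = - t / (1 - \<kappa>)"
    using assms by (simp add: Im_divide power2_eq_square)
  then have "?l \<notin> \<real>\<^sub>\<le>\<^sub>0"
    using False assms by (auto simp: complex_nonpos_Reals_iff)
  then have "(\<lambda>n. ?v n powr of_real \<gamma>) \<longlonglongrightarrow> ?l powr of_real \<gamma>"
    by (intro tendsto_powr_complex v tendsto_const)
  moreover have "\<forall>\<^sub>F n in sequentially. ?v n powr of_real \<gamma> =
      of_nat n * ((1 - iexp (u n)) / (1 - of_real \<kappa> * iexp (u n))) powr of_real \<gamma>"
    using eventually_gt_at_top[of 0]
  proof eventually_elim
    case (elim n)
    have "t / u n = real n powr (1 / \<gamma>)"
      using elim False by (simp add: u_def powr_minus field_simps)
    then have "?v n = of_real (real n powr (1 / \<gamma>)) * ((1 - iexp (u n)) / (1 - of_real \<kappa> * iexp (u n)))"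
      by (simp flip: \<open>t / u n = _\<close> add: divide_simps) (simp add: algebra_simps)
    also have "\<dots> powr of_real \<gamma> = of_real ((real n powr (1 / \<gamma>)) powr \<gamma>) *
        ((1 - iexp (u n)) / (1 - of_real \<kappa> * iexp (u n))) powr of_real \<gamma>"
      using elim by (intro powr_pos_real_mult) auto
    also have "(real n powr (1 / \<gamma>)) powr \<gamma> = real n"
      using assms elim by (simp add: powr_powr)
    finally show ?case by simp
  qed
  ultimately show ?thesis
    unfolding l_powr u_def by (rule Lim_transform_eventually)
qed

lemma imaginary_powr:
  fixes t \<gamma> :: real
  assumes "0 < \<gamma>"
  shows "(- \<i> * of_real t) powr of_real \<gamma> = of_real (\<bar>t\<bar> powr \<gamma>) *
    (of_real (cos (pi * \<gamma> / 2)) - \<i> * of_real (sgn t * sin (pi * \<gamma> / 2)))"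
proof (cases "t = 0")
  case False
  have eq: "- \<i> * of_real t = of_real \<bar>t\<bar> * (- \<i> * of_real (sgn t))"
    by (simp add: sgn_if)
  have "(- \<i> * of_real (sgn t)) powr of_real \<gamma> = cis (- (sgn t * (pi * \<gamma> / 2)))"
    using False by (auto simp: powr_def cis_conv_exp sgn_if mult_ac)
  also have "\<dots> = of_real (cos (pi * \<gamma> / 2)) - \<i> * of_real (sgn t * sin (pi * \<gamma> / 2))"
    using False by (auto simp: complex_eq_iff sgn_if)
  finally show ?thesis
    unfolding eq using False by (subst powr_pos_real_mult) auto
qed (use assms in auto)

section \<open>Existence of the limit law\<close>

text \<open>
  Markov's inequality for \<open>1 - exp (- \<theta> X)\<close>: on the event \<open>X > 1 / \<theta>\<close> this variable
  is at least \<open>d = 1 - exp (- 1)\<close>, so \<open>d\<close> times the probability of that event is at most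
  \<open>1 - l \<theta>\<close>, which is small for small \<open>\<theta>\<close> whatever \<open>n\<close> is.
\<close>
lemma tight_if_Laplace_bound:
  fixes \<mu> :: "nat \<Rightarrow> real measure" and l :: "real \<Rightarrow> real"
  assumes real: "\<And>n. real_distribution (\<mu> n)"
    and nonneg: "\<And>n. AE x in \<mu> n. 0 \<le> x"
    and bound: "\<And>n \<theta>. 0 < \<theta> \<Longrightarrow> l \<theta> \<le> (\<integral>x. exp (- \<theta> * x) \<partial>\<mu> n)"
    and lim: "(l \<longlongrightarrow> 1) (at_right 0)"
  shows "tight \<mu>"
  unfolding tight_def
proof (intro conjI allI impI real)
  fix \<epsilon> :: real assume \<epsilon>: "0 < \<epsilon>"
  define d where "d = 1 - exp (- 1 :: real)"
  have d: "0 < d" by (simp add: d_def)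
  have "\<forall>\<^sub>F \<theta> in at_right 0. 1 - \<epsilon> * d < l \<theta>"
    using lim \<epsilon> d by (intro order_tendstoD) auto
  moreover have "\<forall>\<^sub>F \<theta> in at_right (0::real). 0 < \<theta>"
    by (simp add: eventually_at_right_less)
  ultimately have "\<forall>\<^sub>F \<theta> in at_right (0::real). 0 < \<theta> \<and> 1 - \<epsilon> * d < l \<theta>"
    by eventually_elim auto
  then obtain \<theta> where \<theta>: "0 < \<theta>" "1 - \<epsilon> * d < l \<theta>"
    using eventually_happens[of _ "at_right (0::real)"] by auto
  show "\<exists>a b. a < b \<and> (\<forall>n. 1 - \<epsilon> < measure (\<mu> n) {a<..b})"
  \<comment> \<open>The left end must be negative: the interval is open there and has to contain 0.\<close>
  proof (rule exI[of _ "-1"], rule exI[of _ "1 / \<theta>"], intro conjI allI)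
    show "- 1 < 1 / \<theta>" using \<theta> by (smt (verit) divide_pos_pos)
    fix n
    interpret real_distribution "\<mu> n" by (rule real)
    let ?I = "{-1<..1 / \<theta>}"
    have "l \<theta> \<le> (\<integral>x. exp (- \<theta> * x) \<partial>\<mu> n)" by (rule bound[OF \<theta>(1)])
    also have "\<dots> \<le> (\<integral>x. (1 - d) + d * indicator ?I x \<partial>\<mu> n)"
    proof (rule integral_mono_AE)
      show "integrable (\<mu> n) (\<lambda>x. exp (- \<theta> * x))"
        by (rule integrable_const_bound[where B = 1]) (use nonneg[of n] \<theta> in auto)
      show "integrable (\<mu> n) (\<lambda>x. (1 - d) + d * indicator ?I x)"
        by (intro Bochner_Integration.integrable_add integrable_mult_right integrable_real_indicator) (auto simp: emeasure_eq_measure)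
      show "AE x in \<mu> n. exp (- \<theta> * x) \<le> (1 - d) + d * indicator ?I x"
        using nonneg[of n]
      proof eventually_elim
        case (elim x)
        show ?case
        proof (cases "x \<le> 1 / \<theta>")
          case True then show ?thesis using elim \<theta> by (auto simp: indicator_def)
        next
          case False
          then have "1 \<le> \<theta> * x" using \<theta> by (simp add: field_simps)
          then show ?thesis using False by (auto simp: indicator_def d_def)
        qed
      qed
    qed
    also have "\<dots> = (1 - d) + d * prob ?I"
      by (subst Bochner_Integration.integral_add) (auto simp: prob_space emeasure_eq_measure simp del: space_eq_univ)
    finally have "d * (1 - \<epsilon>) < d * prob ?I"
      using \<theta>(2) by (simp add: algebra_simps)
    then show "1 - \<epsilon> < prob ?I" using d by simp
  qed
qed

text \<open>
  At \<open>z = exp (- s)\<close> the quotient inside the power has numerator at most \<open>s\<close> and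
  denominator at least \<open>1 - \<kappa>\<close>. The resulting bound is invariant under
  replacing \<open>lam\<close> by \<open>n lam\<close> and \<open>s\<close> by \<open>n powr (- 1 / \<gamma>) s\<close>, which makes it
  uniform over the normalised sums.
\<close>
lemma PDS_Laplace_bound:
  assumes "0 < \<gamma>" "\<gamma> \<le> 1" "0 < lam" "0 \<le> \<kappa>" "\<kappa> < 1" "0 \<le> s"
  shows "exp (- lam * (s / (1 - \<kappa>)) powr \<gamma>) \<le>
         measure_pmf.expectation (PDS \<gamma> lam \<kappa>) (\<lambda>k. exp (- s * real k))"
proof -
  have "measure_pmf.expectation (PDS \<gamma> lam \<kappa>) (\<lambda>k. exp (- s * real k)) =
        measure_pmf.expectation (PDS \<gamma> lam \<kappa>) (\<lambda>k. exp (- s) ^ k)"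
    by (simp add: exp_of_nat_mult[symmetric] mult_ac)
  also have "\<dots> = exp (- lam * ((1 - exp (- s)) / (1 - \<kappa> * exp (- s))) powr \<gamma>)"
    using assms by (intro PDS_pgf) auto
  finally have eq: "measure_pmf.expectation (PDS \<gamma> lam \<kappa>) (\<lambda>k. exp (- s * real k)) = \<dots>" .
  have "1 - exp (- s) \<le> s" using exp_ge_add_one_self[of "- s"] by linarith
  moreover have "1 - \<kappa> \<le> 1 - \<kappa> * exp (- s)" using assms by (simp add: mult_left_le)
  ultimately have "(1 - exp (- s)) / (1 - \<kappa> * exp (- s)) \<le> s / (1 - \<kappa>)"
    using assms by (intro frac_le) auto
  moreover have "0 \<le> (1 - exp (- s)) / (1 - \<kappa> * exp (- s))"
    using assms \<open>1 - \<kappa> \<le> 1 - \<kappa> * exp (- s)\<close> by (intro divide_nonneg_nonneg) auto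
  ultimately show ?thesis
    unfolding eq using assms by (auto intro!: mult_left_mono powr_mono2)
qed

text \<open>
  The laws \<open>PDS \<gamma> (n lam) \<kappa>\<close>, being those of the sums of \<open>n\<close> independent copies,
  are used directly in place of the sums, so that no product space is involved. The index is
  shifted to \<open>n = Suc m\<close> because the intensity \<open>n lam\<close> must be positive.
\<close>
lemma stable_limit_exists:
  fixes \<gamma> lam \<kappa> :: real
  assumes "0 < \<gamma>" "\<gamma> \<le> 1" "0 < lam" "0 \<le> \<kappa>" "\<kappa> < 1"
  shows "\<exists>L. real_distribution L \<and> (\<forall>t. char L t =
    exp (- of_real (lam / (1 - \<kappa>) powr \<gamma>) * (- \<i> * of_real t) powr of_real \<gamma>))"
proof -
  define \<mu> where "\<mu> = (\<lambda>m. distr (PDS \<gamma> (real (Suc m) * lam) \<kappa>) borel (\<lambda>k. real (Suc m) powr (- 1 / \<gamma>) * real k))"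
  have real: "real_distribution (\<mu> m)" for m
    unfolding \<mu>_def by (intro prob_space.real_distribution_distr[OF prob_space_measure_pmf]) auto
  have "tight \<mu>"
  proof (rule tight_if_Laplace_bound[where l = "\<lambda>\<theta>. exp (- lam * (\<theta> / (1 - \<kappa>)) powr \<gamma>)"])
    show "AE x in \<mu> m. 0 \<le> x" for m
      unfolding \<mu>_def by (subst AE_distr_iff) auto
    show "((\<lambda>\<theta>. exp (- lam * (\<theta> / (1 - \<kappa>)) powr \<gamma>)) \<longlongrightarrow> 1) (at_right 0)"
    proof -
      have "((\<lambda>\<theta>. (\<theta> / (1 - \<kappa>)) powr \<gamma>) \<longlongrightarrow> 0) (at_right 0)"
        using assms by real_asymp
      then have "((\<lambda>\<theta>. exp (- lam * (\<theta> / (1 - \<kappa>)) powr \<gamma>)) \<longlongrightarrow> exp (- lam * 0)) (at_right 0)"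
        by (intro tendsto_intros)
      then show ?thesis by simp
    qed
    fix m and \<theta> :: real assume \<theta>: "0 < \<theta>"
    let ?s = "\<theta> * real (Suc m) powr (- 1 / \<gamma>)"
    have "(?s / (1 - \<kappa>)) powr \<gamma> = (real (Suc m) powr (- 1 / \<gamma>)) powr \<gamma> * (\<theta> / (1 - \<kappa>)) powr \<gamma>"
      using assms \<theta> by (simp add: powr_divide powr_mult)
    also have "(real (Suc m) powr (- 1 / \<gamma>)) powr \<gamma> = 1 / real (Suc m)"
      unfolding powr_powr using assms by (simp add: powr_minus_divide)
    finally have s: "lam * (\<theta> / (1 - \<kappa>)) powr \<gamma> = real (Suc m) * lam * (?s / (1 - \<kappa>)) powr \<gamma>"
      by simp
    have "exp (- lam * (\<theta> / (1 - \<kappa>)) powr \<gamma>) = exp (- (real (Suc m) * lam) * (?s / (1 - \<kappa>)) powr \<gamma>)"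
      using s by simp
    also have "\<dots> \<le> measure_pmf.expectation (PDS \<gamma> (real (Suc m) * lam) \<kappa>) (\<lambda>k. exp (- ?s * real k))"
      using assms \<theta> by (intro PDS_Laplace_bound) auto
    also have "\<dots> = (\<integral>x. exp (- \<theta> * x) \<partial>\<mu> m)"
      unfolding \<mu>_def by (subst integral_distr) (auto simp: mult_ac)
    finally show "exp (- lam * (\<theta> / (1 - \<kappa>)) powr \<gamma>) \<le> (\<integral>x. exp (- \<theta> * x) \<partial>\<mu> m)" .
  qed (rule real)
  then obtain r L where r: "strict_mono (r :: nat \<Rightarrow> nat)" and L: "real_distribution L" "weak_conv_m (\<mu> \<circ> id \<circ> r) L"
    using tight_imp_convergent_subsubsequence[of \<mu> id] by (auto simp: strict_mono_def)
  have lim: "(\<lambda>m. char (\<mu> m) t) \<longlonglongrightarrow> exp (- of_real (lam / (1 - \<kappa>) powr \<gamma>) * (- \<i> * of_real t) powr of_real \<gamma>)" for t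
  proof -
    define w where "w = (\<lambda>n. ((1 - iexp (real n powr (- 1 / \<gamma>) * t)) /
            (1 - of_real \<kappa> * iexp (real n powr (- 1 / \<gamma>) * t))) powr of_real \<gamma>)"
    have "(\<lambda>m. exp (- of_real lam * (of_nat (Suc m) * w (Suc m)))) \<longlonglongrightarrow>
      exp (- of_real lam * (of_real (1 / (1 - \<kappa>) powr \<gamma>) * (- \<i> * of_real t) powr of_real \<gamma>))"
      unfolding w_def using assms
      by (intro tendsto_exp tendsto_mult tendsto_const LIMSEQ_Suc[OF moebius_scaled_limit]) auto
    moreover have "char (\<mu> m) t = exp (- of_real lam * (of_nat (Suc m) * w (Suc m)))" for m
      unfolding \<mu>_def using assms by (subst char_PDS_scaled) (simp_all add: w_def mult_ac)
    ultimately show ?thesis by simp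
  qed
  have "char L t = exp (- of_real (lam / (1 - \<kappa>) powr \<gamma>) * (- \<i> * of_real t) powr of_real \<gamma>)" for t
  proof (rule LIMSEQ_unique)
    show "(\<lambda>n. char ((\<mu> \<circ> id \<circ> r) n) t) \<longlonglongrightarrow> char L t"
      by (rule levy_continuity1[OF _ L]) (simp add: real)
    show "(\<lambda>n. char ((\<mu> \<circ> id \<circ> r) n) t) \<longlonglongrightarrow> exp (- of_real (lam / (1 - \<kappa>) powr \<gamma>) * (- \<i> * of_real t) powr of_real \<gamma>)"
      using LIMSEQ_subseq_LIMSEQ[OF lim r] by (simp add: comp_def)
  qed
  with L show ?thesis by blast
qed

section \<open>Stability and normal attraction\<close>

lemma char_distr_scale:
  assumes "X \<in> borel_measurable M"
  shows "char (distr M borel (\<lambda>\<omega>. c * X \<omega>)) t = char (distr M borel X) (c * t)"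
  using assms unfolding char_def by (simp add: integral_distr mult_ac)

text \<open>
  The coordinates of a product space are independent because their joint law is the product measure
  itself.
\<close>
lemma char_distr_PiM_sum:
  assumes L: "real_distribution L" and n: "1 \<le> n"
  shows "char (distr (\<Pi>\<^sub>M i\<in>{..<n::nat}. L) borel (\<lambda>x. \<Sum>i<n. x i)) t = char L t ^ n"
proof -
  interpret L: real_distribution L by (rule L)
  let ?P = "\<Pi>\<^sub>M i\<in>{..<n}. L"
  interpret P: prob_space ?P
    by (intro prob_space_PiM) unfold_locales
  have comp: "distr ?P borel (\<lambda>x. x i) = L" if "i < n" for i
  proof -
    have "distr ?P borel (\<lambda>x. x i) = distr ?P L (\<lambda>x. x i)"
      by (rule distr_cong) auto
    also have "\<dots> = L"
      using that by (intro distr_PiM_component) (auto intro: L.prob_space_axioms)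
    finally show ?thesis .
  qed
  have "P.indep_vars (\<lambda>_. borel) (\<lambda>i x. x i) {..<n}"
  proof (subst P.indep_vars_iff_distr_eq_PiM')
    have "distr ?P (\<Pi>\<^sub>M i\<in>{..<n}. borel) (\<lambda>x. \<lambda>i\<in>{..<n}. x i) = distr ?P ?P (\<lambda>x. x)"
      by (intro distr_cong sets_PiM_cong) (auto simp: space_PiM)
    also have "\<dots> = ?P" by simp
    also have "\<dots> = (\<Pi>\<^sub>M i\<in>{..<n}. distr ?P borel (\<lambda>x. x i))"
      by (intro PiM_cong) (auto simp: comp)
    finally show "distr ?P (\<Pi>\<^sub>M i\<in>{..<n}. borel) (\<lambda>x. \<lambda>i\<in>{..<n}. x i) =
      (\<Pi>\<^sub>M i\<in>{..<n}. distr ?P borel (\<lambda>x. x i))" .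
  qed (use n in \<open>auto simp: lessThan_empty_iff\<close>)
  then have "char (distr ?P borel (\<lambda>x. \<Sum>i<n. x i)) t = (\<Prod>i<n. char (distr ?P borel (\<lambda>x. x i)) t)"
    by (rule P.char_distr_sum)
  then show ?thesis by (simp add: comp)
qed

text \<open>
  Homogeneity of the exponent under positive scaling of \<open>t\<close> makes the law strictly stable: the
  shift \<open>d\<close> can be taken to be 0.
\<close>
lemma stable_lawI_char:
  assumes \<alpha>: "0 < \<alpha>" "\<alpha> \<le> 2" and L: "real_distribution L"
    and char: "\<And>t. char L t = exp (- of_real c * (- \<i> * of_real t) powr of_real \<alpha>)"
  shows "stable_law \<alpha> L"
  unfolding stable_law_def
proof (intro conjI allI impI \<alpha> L)
  fix n :: nat assume n: "1 \<le> n"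
  interpret L: real_distribution L by (rule L)
  interpret P: prob_space "\<Pi>\<^sub>M i\<in>{..<n}. L"
    by (intro prob_space_PiM) unfold_locales
  have "distr (\<Pi>\<^sub>M i\<in>{..<n}. L) borel (\<lambda>x. \<Sum>i<n. x i) = distr L borel (\<lambda>x. real n powr (1 / \<alpha>) * x)"
  proof (rule Levy_uniqueness)
    show "real_distribution (distr (\<Pi>\<^sub>M i\<in>{..<n}. L) borel (\<lambda>x. \<Sum>i<n. x i))"
      by (intro P.real_distribution_distr borel_measurable_sum) measurable
    show "real_distribution (distr L borel (\<lambda>x. real n powr (1 / \<alpha>) * x))"
      by (intro L.real_distribution_distr) measurable
    show "char (distr (\<Pi>\<^sub>M i\<in>{..<n}. L) borel (\<lambda>x. \<Sum>i<n. x i)) = char (distr L borel (\<lambda>x. real n powr (1 / \<alpha>) * x))"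
    proof
      fix t
      have id: "distr L borel (\<lambda>x. x) = L"
        by (intro distr_id2) simp
      have "(- \<i> * of_real (real n powr (1 / \<alpha>) * t)) powr of_real \<alpha> =
        (of_real (real n powr (1 / \<alpha>)) * (- \<i> * of_real t)) powr of_real \<alpha>"
        by (simp add: mult_ac)
      also have "\<dots> = of_nat n * (- \<i> * of_real t) powr of_real \<alpha>"
        using n \<alpha> by (subst powr_pos_real_mult) (auto simp: powr_powr)
      finally have scale: "(- \<i> * of_real (real n powr (1 / \<alpha>) * t)) powr of_real \<alpha> =
        of_nat n * (- \<i> * of_real t) powr of_real \<alpha>" .
      have "char (distr L borel (\<lambda>x. real n powr (1 / \<alpha>) * x)) t = char L (real n powr (1 / \<alpha>) * t)"
        by (subst char_distr_scale) (auto simp: id)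
      also have "\<dots> = char L t ^ n"
        unfolding char scale exp_of_nat_mult[symmetric] by (simp add: mult_ac)
      finally have "char (distr L borel (\<lambda>x. real n powr (1 / \<alpha>) * x)) t = char L t ^ n" .
      then show "char (distr (\<Pi>\<^sub>M i\<in>{..<n}. L) borel (\<lambda>x. \<Sum>i<n. x i)) t =
          char (distr L borel (\<lambda>x. real n powr (1 / \<alpha>) * x)) t"
        by (simp add: char_distr_PiM_sum[OF L n])
    qed
  qed
  then show "\<exists>d. distr (\<Pi>\<^sub>M i\<in>{..<n}. L) borel (\<lambda>x. \<Sum>i<n. x i) = distr L borel (\<lambda>x. real n powr (1 / \<alpha>) * x + d)"
    by (intro exI[of _ 0]) simp
qed

lemma normal_attractionI_char:
  assumes L: "real_distribution L"
    and lim: "\<And>t. (\<lambda>n. char D (real n powr (- 1 / \<alpha>) * t) ^ n) \<longlonglongrightarrow> char L t"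
  shows "in_domain_of_normal_attraction TYPE('a) D \<alpha> L"
  unfolding in_domain_of_normal_attraction_def
proof (intro allI impI, elim conjE)
  fix M :: "'a measure" and X :: "nat \<Rightarrow> 'a \<Rightarrow> real"
  assume "prob_space M" and indep: "prob_space.indep_vars M (\<lambda>_. borel) X UNIV" and D: "\<forall>i. distr M borel (X i) = D"
  interpret prob_space M by fact
  have [measurable]: "random_variable borel (X i)" for i
    using indep by (auto simp: indep_vars_def)
  show "weak_conv_m (\<lambda>n. distr M borel (\<lambda>\<omega>. real n powr (- 1 / \<alpha>) * (\<Sum>i<n. X i \<omega>))) L"
  proof (rule levy_continuity)
    show "real_distribution (distr M borel (\<lambda>\<omega>. real n powr (- 1 / \<alpha>) * (\<Sum>i<n. X i \<omega>)))" for n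
      by (intro real_distribution_distr) measurable
    have "char (distr M borel (\<lambda>\<omega>. real n powr (- 1 / \<alpha>) * (\<Sum>i<n. X i \<omega>))) t =
        char D (real n powr (- 1 / \<alpha>) * t) ^ n" for n t
      using indep_vars_subset[OF indep, of "{..<n}"]
      by (subst char_distr_scale) (auto simp: char_distr_sum D)
    then show "(\<lambda>n. char (distr M borel (\<lambda>\<omega>. real n powr (- 1 / \<alpha>) * (\<Sum>i<n. X i \<omega>))) t) \<longlonglongrightarrow> char L t" for t
      using lim by simp
  qed (rule L)
qed

theorem proposition3p12:
  fixes \<gamma> lam \<kappa> :: real
  assumes "0 < \<gamma>" "\<gamma> \<le> 1" "0 < lam" "0 \<le> \<kappa>" "\<kappa> < 1"
  shows "\<exists>L. real_distribution L \<and> stable_law \<gamma> L \<and>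
    char L = (\<lambda>t. exp (- (complex_of_real (lam / (1 - \<kappa>) powr \<gamma> * \<bar>t\<bar> powr \<gamma>) *
      (complex_of_real (cos (pi * \<gamma> / 2)) - \<i> * complex_of_real (sgn t * sin (pi * \<gamma> / 2)))))) \<and>
    in_domain_of_normal_attraction TYPE('a) (distr (measure_pmf (PDS \<gamma> lam \<kappa>)) borel real) \<gamma> L"
proof -
  obtain L where L: "real_distribution L" and char:
    "\<And>t. char L t = exp (- of_real (lam / (1 - \<kappa>) powr \<gamma>) * (- \<i> * of_real t) powr of_real \<gamma>)"
    using stable_limit_exists[OF assms] by blast
  have "stable_law \<gamma> L"
    using assms L char by (intro stable_lawI_char[where c = "lam / (1 - \<kappa>) powr \<gamma>"]) auto
  moreover have "char L = (\<lambda>t. exp (- (complex_of_real (lam / (1 - \<kappa>) powr \<gamma> * \<bar>t\<bar> powr \<gamma>) *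
      (complex_of_real (cos (pi * \<gamma> / 2)) - \<i> * complex_of_real (sgn t * sin (pi * \<gamma> / 2))))))"
    unfolding char imaginary_powr[OF assms(1)] fun_eq_iff by (simp add: mult.assoc)
  moreover have "in_domain_of_normal_attraction TYPE('a) (distr (measure_pmf (PDS \<gamma> lam \<kappa>)) borel real) \<gamma> L"
  proof (rule normal_attractionI_char[OF L])
    fix t
    define w where "w = (\<lambda>s. ((1 - iexp s) / (1 - of_real \<kappa> * iexp s)) powr of_real \<gamma>)"
    have "char (distr (measure_pmf (PDS \<gamma> lam \<kappa>)) borel real) s = exp (- of_real lam * w s)" for s
      using char_PDS_scaled[OF assms, of 1 s] by (simp add: w_def)
    then have "char (distr (measure_pmf (PDS \<gamma> lam \<kappa>)) borel real) s ^ n = exp (- of_real lam * (of_nat n * w s))" for s n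
      by (simp add: exp_of_nat_mult[symmetric] mult_ac)
    moreover have "(\<lambda>n. exp (- of_real lam * (of_nat n * w (real n powr (- 1 / \<gamma>) * t)))) \<longlonglongrightarrow>
      exp (- of_real lam * (of_real (1 / (1 - \<kappa>) powr \<gamma>) * (- \<i> * of_real t) powr of_real \<gamma>))"
      unfolding w_def using assms by (intro tendsto_exp tendsto_mult tendsto_const moebius_scaled_limit) auto
    ultimately show "(\<lambda>n. char (distr (measure_pmf (PDS \<gamma> lam \<kappa>)) borel real) (real n powr (- 1 / \<gamma>) * t) ^ n) \<longlonglongrightarrow> char L t"
      by (simp add: char)
  qed
  ultimately show ?thesis using L by blast
qed

end
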